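(* Let $\Phi=(A;\{E_i\}_{i=0}^d;A^*;\{E_i^*\}_{i=0}^d)$ be a tridiagonal system of diameter $d\geq 1$ on $V$ over $\mathbb{K}$, with first split decomposition $\{U_i\}_{i=0}^d$, and let $\Psi\in\mathrm{End}(V)$ be the linear transformation attached to $\Phi$ as defined in the context. Then $$\Psi U_j\subseteq U_{j-1}\quad(1\le j\le d),\qquad \Psi U_0=0.$$
   Context: $\mathbb{K}$ is a field, $V$ is a $\mathbb{K}$-vector space of finite positive dimension, $\mathrm{End}(V)$ is the algebra of linear maps $V\to V$. A tridiagonal pair (TD pair) on $V$ is an ordered pair $A,A^*\in\mathrm{End}(V)$ ($A^*$ is just a name, not an adjoint) such that: (i) $A$ and $A^*$ are each diagonalizable over $\mathbb{K}$; (ii) there is an ordering $\{V_i\}_{i=0}^d$ of the eigenspaces of $A$ with $A^*V_i\subseteq V_{i-1}+V_i+V_{i+1}$ for $0\le i\le d$, where $V_{-1}=V_{d+1}=0$; (iii) there is an ordering $\{V_i^*\}_{i=0}^{\delta}$ of the eigenspaces of $A^*$ with $AV_i^*\subseteq V_{i-1}^*+V_i^*+V_{i+1}^*$ for $0\le i\le\delta$, where $V_{-1}^*=V_{\delta+1}^*=0$; (iv) there is no subspace $W$ of $V$ with $AW\subseteq W$, $A^*W\subseteq W$, $W\ne0$, $W\ne V$. It is known that $d=\delta$; this is the diameter, and it is assumed that $d\ge1$. Orderings satisfying (ii) (resp. (iii)) are called standard. The primitive idempotent of a diagonalizable map associated with one of its eigenspaces is the projection of $V$ onto that eigenspace that kills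 the other eigenspaces. A tridiagonal system (TD system) on $V$ is a sequence $\Phi=(A;\{E_i\}_{i=0}^d;A^*;\{E_i^*\}_{i=0}^d)$ where $A,A^*$ is a TD pair on $V$, $\{E_i\}_{i=0}^d$ is an ordering of the primitive idempotents of $A$ such that $\{E_iV\}_{i=0}^d$ is standard, and $\{E_i^*\}_{i=0}^d$ is an ordering of the primitive idempotents of $A^*$ such that $\{E_i^*V\}_{i=0}^d$ is standard. Let $\theta_i$ be the eigenvalue of $A$ on $E_iV$. For $0\le i\le d$ set $U_i=(E_0^*V+\cdots+E_i^*V)\cap(E_iV+\cdots+E_dV)$. It is known that $V=\bigoplus_{i=0}^dU_i$ (first split decomposition). For $0\le i\le d/2$ set $K_i=(E_0^*V+\cdots+E_i^*V)\cap(E_iV+E_{i+1}V+\cdots+E_{d-i}V)$. For $0\le i\le j\le d+1$ set $\tau_{ij}=(x-\theta_i)(x-\theta_{i+1})\cdots(x-\theta_{j-1})\in\mathbb{K}[x]$, with $\tau_{ii}=1$ and $\tau_{i,i-1}=0$. For $0\le i\le d+1$ set $\vartheta_i=\sum_{h=0}^{i-1}\frac{\theta_h-\theta_{d-h}}{\theta_0-\theta_d}$. It is known that $V=\bigoplus_{0\le i\le d/2}\bigoplus_{j=i}^{d-i}\tau_{ij}(A)K_i$. $\Psi$ is the unique element of $\mathrm{End}(V)$ such that $\Psi\tau_{ij}(A)v=(\vartheta_j-\vartheta_i)\tau_{i,j-1}(A)v$ for all $0\le i\le d/2$, $i\le j\le d-i$, $v\in K_i$. *)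

theory Defs
  imports
    Complex_Main
    "HOL-Library.Set_Algebras"
    "HOL-Computational_Algebra.Polynomial"
begin

text \<open>
  The vector space \<open>V\<close> is the whole type \<open>'v\<close> with scalar multiplication \<open>scale\<close> over the
  field \<open>'k\<close>, and \<open>End(V)\<close> consists of the maps \<open>A\<close> with \<open>Vector_Spaces.linear scale scale A\<close>.
  Sums of subspaces are the elementwise sums of HOL-Library.Set_Algebras,
  so that an empty sum of subspaces is \<open>0 = {0}\<close>.
\<close>

definition eigenspace ::
  "('k::field \<Rightarrow> 'v::ab_group_add \<Rightarrow> 'v) \<Rightarrow> ('v \<Rightarrow> 'v) \<Rightarrow> 'k \<Rightarrow> 'v set" where
  "eigenspace scale A t = {v. A v = scale t v}"

definition eigenspaces ::
  "('k::field \<Rightarrow> 'v::ab_group_add \<Rightarrow> 'v) \<Rightarrow> ('v \<Rightarrow> 'v) \<Rightarrow> 'v set set" where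
  "eigenspaces scale A = {eigenspace scale A t | t. eigenspace scale A t \<noteq> {0}}"

definition diagonalizable ::
  "('k::field \<Rightarrow> 'v::ab_group_add \<Rightarrow> 'v) \<Rightarrow> ('v \<Rightarrow> 'v) \<Rightarrow> bool" where
  "diagonalizable scale A \<longleftrightarrow>
     (\<exists>B. \<not> module.dependent scale B \<and> module.span scale B = UNIV \<and>
          (\<forall>b\<in>B. \<exists>t. A b = scale t b))"

text \<open>
  The index set \<open>{j \<in> {0..d}. i \<le> j + 1 \<and> j \<le> i + 1}\<close> is \<open>{i - 1, i, i + 1}\<close> cut down to
  \<open>{0..d}\<close>, which accounts for the convention that the terms with indices \<open>-1\<close> and \<open>d + 1\<close> are zero.
\<close>

definition standard_ordering ::
  "('k::field \<Rightarrow> 'v::ab_group_add \<Rightarrow> 'v) \<Rightarrow> ('v \<Rightarrow> 'v) \<Rightarrow> ('v \<Rightarrow> 'v) \<Rightarrow> nat \<Rightarrow> (nat \<Rightarrow> 'v set) \<Rightarrow> bool"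
  where
  "standard_ordering scale A B d W \<longleftrightarrow>
     bij_betw W {0..d} (eigenspaces scale A) \<and>
     (\<forall>i\<in>{0..d}. B ` W i \<subseteq> (\<Sum>j\<in>{j \<in> {0..d}. i \<le> j + 1 \<and> j \<le> i + 1}. W j))"

definition TD_pair ::
  "('k::field \<Rightarrow> 'v::ab_group_add \<Rightarrow> 'v) \<Rightarrow> ('v \<Rightarrow> 'v) \<Rightarrow> ('v \<Rightarrow> 'v) \<Rightarrow> bool" where
  "TD_pair scale A Astar \<longleftrightarrow>
     Vector_Spaces.linear scale scale A \<and> Vector_Spaces.linear scale scale Astar \<and>
     diagonalizable scale A \<and> diagonalizable scale Astar \<and>
     (\<exists>d W. standard_ordering scale A Astar d W) \<and>
     (\<exists>\<delta> Wstar. standard_ordering scale Astar A \<delta> Wstar) \<and>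
     \<not> (\<exists>W. module.subspace scale W \<and> A ` W \<subseteq> W \<and> Astar ` W \<subseteq> W \<and> W \<noteq> {0} \<and> W \<noteq> UNIV)"

definition primitive_idempotent ::
  "('k::field \<Rightarrow> 'v::ab_group_add \<Rightarrow> 'v) \<Rightarrow> ('v \<Rightarrow> 'v) \<Rightarrow> ('v \<Rightarrow> 'v) \<Rightarrow> bool" where
  "primitive_idempotent scale A P \<longleftrightarrow>
     Vector_Spaces.linear scale scale P \<and>
     (\<exists>W\<in>eigenspaces scale A.
        range P = W \<and> (\<forall>v\<in>W. P v = v) \<and> (\<forall>W'\<in>eigenspaces scale A - {W}. \<forall>v\<in>W'. P v = 0))"

definition TD_system ::
  "('k::field \<Rightarrow> 'v::ab_group_add \<Rightarrow> 'v) \<Rightarrow> nat \<Rightarrow>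
   ('v \<Rightarrow> 'v) \<Rightarrow> (nat \<Rightarrow> 'v \<Rightarrow> 'v) \<Rightarrow> ('v \<Rightarrow> 'v) \<Rightarrow> (nat \<Rightarrow> 'v \<Rightarrow> 'v) \<Rightarrow> bool" where
  "TD_system scale d A E Astar Estar \<longleftrightarrow>
     TD_pair scale A Astar \<and>
     bij_betw E {0..d} {P. primitive_idempotent scale A P} \<and>
     standard_ordering scale A Astar d (\<lambda>i. range (E i)) \<and>
     bij_betw Estar {0..d} {P. primitive_idempotent scale Astar P} \<and>
     standard_ordering scale Astar A d (\<lambda>i. range (Estar i))"

definition eigenvalue_on ::
  "('k::field \<Rightarrow> 'v::ab_group_add \<Rightarrow> 'v) \<Rightarrow> ('v \<Rightarrow> 'v) \<Rightarrow> 'v set \<Rightarrow> 'k" where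
  "eigenvalue_on scale A W = (THE t. \<forall>v\<in>W. A v = scale t v)"

definition split_U ::
  "nat \<Rightarrow> (nat \<Rightarrow> 'v \<Rightarrow> 'v::ab_group_add) \<Rightarrow> (nat \<Rightarrow> 'v \<Rightarrow> 'v) \<Rightarrow> nat \<Rightarrow> 'v set" where
  "split_U d E Estar i = (\<Sum>h\<in>{0..i}. range (Estar h)) \<inter> (\<Sum>h\<in>{i..d}. range (E h))"

definition split_K ::
  "nat \<Rightarrow> (nat \<Rightarrow> 'v \<Rightarrow> 'v::ab_group_add) \<Rightarrow> (nat \<Rightarrow> 'v \<Rightarrow> 'v) \<Rightarrow> nat \<Rightarrow> 'v set" where
  "split_K d E Estar i = (\<Sum>h\<in>{0..i}. range (Estar h)) \<inter> (\<Sum>h\<in>{i..d - i}. range (E h))"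

text \<open>The second index of \<open>\<tau>\<close> is an integer, so that \<open>\<tau>\<^sub>i\<^sub>,\<^sub>i\<^sub>-\<^sub>1 = 0\<close> makes sense for \<open>i = 0\<close>.\<close>

definition tau :: "(nat \<Rightarrow> 'k::field) \<Rightarrow> nat \<Rightarrow> int \<Rightarrow> 'k poly" where
  "tau \<theta> i j = (if j < int i then 0 else \<Prod>h\<in>{i..<nat j}. [:- \<theta> h, 1:])"

definition vartheta :: "(nat \<Rightarrow> 'k::field) \<Rightarrow> nat \<Rightarrow> nat \<Rightarrow> 'k" where
  "vartheta \<theta> d i = (\<Sum>h\<in>{0..<i}. (\<theta> h - \<theta> (d - h)) / (\<theta> 0 - \<theta> d))"

definition poly_map ::
  "('k::field \<Rightarrow> 'v::ab_group_add \<Rightarrow> 'v) \<Rightarrow> 'k poly \<Rightarrow> ('v \<Rightarrow> 'v) \<Rightarrow> 'v \<Rightarrow> 'v" where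
  "poly_map scale p A v = (\<Sum>k\<in>{0..degree p}. scale (coeff p k) ((A ^^ k) v))"

text \<open>
  The property that characterizes \<open>\<Psi>\<close> as an element of \<open>End(V)\<close>. For a TD system of diameter
  \<open>d \<ge> 1\<close> there is exactly one such element, because \<open>V\<close> is the direct sum of the subspaces
  \<open>\<tau>\<^sub>i\<^sub>j(A) K\<^sub>i\<close>.
\<close>

definition is_Psi ::
  "('k::field \<Rightarrow> 'v::ab_group_add \<Rightarrow> 'v) \<Rightarrow> nat \<Rightarrow>
   ('v \<Rightarrow> 'v) \<Rightarrow> (nat \<Rightarrow> 'v \<Rightarrow> 'v) \<Rightarrow> (nat \<Rightarrow> 'v \<Rightarrow> 'v) \<Rightarrow> ('v \<Rightarrow> 'v) \<Rightarrow> bool" where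
  "is_Psi scale d A E Estar \<Psi> \<longleftrightarrow>
     Vector_Spaces.linear scale scale \<Psi> \<and>
     (let \<theta> = (\<lambda>i. eigenvalue_on scale A (range (E i))) in
      \<forall>i j. 2 * i \<le> d \<longrightarrow> i \<le> j \<longrightarrow> j \<le> d - i \<longrightarrow>
        (\<forall>v\<in>split_K d E Estar i.
           \<Psi> (poly_map scale (tau \<theta> i (int j)) A v) =
           scale (vartheta \<theta> d j - vartheta \<theta> d i)
             (poly_map scale (tau \<theta> i (int j - 1)) A v)))"

end

theory Submission
  imports Defs
begin

text \<open>
  Write \<open>\<tau>\<^sub>i\<^sub>j(A)\<close> for the product of the maps \<open>A - \<theta>\<^sub>h\<close> with \<open>i \<le> h < j\<close>. Everything rests on the equality
  \<open>U\<^sub>j = \<Sum>\<^sub>h \<tau>\<^sub>h\<^sub>j(A) K\<^sub>h\<close>, the sum over \<open>h \<le> min j (d - j)\<close>: the map \<open>\<Psi>\<close> sends \<open>\<tau>\<^sub>h\<^sub>j(A) v\<close> with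
  \<open>v \<in> K\<^sub>h\<close> to a multiple of \<open>\<tau>\<^sub>h\<^sub>,\<^sub>j\<^sub>-\<^sub>1(A) v\<close>, which is zero for \<open>h = j\<close> and otherwise lies in \<open>U\<^sub>j\<^sub>-\<^sub>1\<close>,
  because \<open>K\<^sub>h \<subseteq> U\<^sub>h\<close> and \<open>A - \<theta>\<^sub>i\<close> maps \<open>U\<^sub>i\<close> into \<open>U\<^sub>i\<^sub>+\<^sub>1\<close>. Only the inclusion of \<open>U\<^sub>j\<close> in the sum
  takes work (lemma \<open>U_subset_string_span\<close>).

  It has the shape of the decomposition of an \<open>sl\<^sub>2\<close>-module into strings. Suppose that
  \<open>\<tau>\<^sub>i\<^sub>,\<^sub>d\<^sub>-\<^sub>i(A)\<close> maps \<open>U\<^sub>i\<close> onto \<open>U\<^sub>d\<^sub>-\<^sub>i\<close> for \<open>i \<le> d/2\<close>. For \<open>u \<in> U\<^sub>j\<^sub>+\<^sub>1\<close> in the lower half there is then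
  \<open>w \<in> U\<^sub>j\<close> such that \<open>u\<close> and \<open>(A - \<theta>\<^sub>j) w\<close> have the same image in \<open>U\<^sub>d\<^sub>-\<^sub>j\<close>, and their difference lies in
  \<open>K\<^sub>j\<^sub>+\<^sub>1\<close>. Hence \<open>U\<^sub>j\<^sub>+\<^sub>1 = K\<^sub>j\<^sub>+\<^sub>1 + (A - \<theta>\<^sub>j) U\<^sub>j\<close>, which gives the lower half by induction, and the
  surjection carries the result to the upper half.

  The surjectivity (lemma \<open>node_map_surjective\<close>) compares two split decompositions of \<open>V\<close>, for the
  orderings \<open>E\<^sub>0, \<dots>, E\<^sub>d\<close> and \<open>E\<^sub>d, \<dots>, E\<^sub>0\<close>. Let \<open>m = d - i\<close>. Since \<open>\<tau>\<^sub>0\<^sub>m(A)\<close> is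
  invertible on \<open>E\<^sub>mV + \<dots> + E\<^sub>dV\<close>, each element of \<open>U\<^sub>m\<close> is the image of some vector under it.
  The second decomposition shows that every vector is congruent to some
  \<open>y \<in> E\<^sup>*\<^sub>0V + \<dots> + E\<^sup>*\<^sub>iV\<close> modulo the kernel \<open>E\<^sub>0V + \<dots> + E\<^sub>m\<^sub>-\<^sub>1V\<close> of \<open>\<tau>\<^sub>0\<^sub>m(A)\<close>. The first
  decomposition writes \<open>y\<close> as a sum of elements of \<open>U\<^sub>0, \<dots>, U\<^sub>i\<close>, and on each \<open>U\<^sub>h\<close> the map \<open>\<tau>\<^sub>0\<^sub>m(A)\<close> agrees with a
  multiple of \<open>\<tau>\<^sub>h\<^sub>m(A) = \<tau>\<^sub>i\<^sub>m(A) \<tau>\<^sub>h\<^sub>i(A)\<close> modulo \<open>E\<^sub>m\<^sub>+\<^sub>1V + \<dots> + E\<^sub>dV\<close>, which meets \<open>U\<^sub>m\<close> only in zero.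

  Both split decompositions come from irreducibility. For fixed \<open>r\<close>, the spaces
  \<open>(E\<^sup>*\<^sub>0V + \<dots> + E\<^sup>*\<^sub>aV) \<inter> (E\<^sub>a\<^sub>+\<^sub>rV + \<dots> + E\<^sub>dV)\<close> together span an invariant subspace. It is proper
  for \<open>r \<ge> 1\<close>, hence zero, and nonzero for \<open>r = 0\<close>, hence all of \<open>V\<close>.
\<close>

section \<open>Diagonalizable maps in coordinates\<close>

text \<open>
  The primitive idempotents of a diagonalizable map serve as coordinates: a vector is determined by
  its components \<open>E h v\<close>, and a polynomial in \<open>A\<close> multiplies the component with index \<open>h\<close> by its
  value at \<open>\<theta> h\<close>. Identities between polynomials in \<open>A\<close>, and the subspaces spanned by some of the
  eigenspaces, are then handled one component at a time.
\<close>

locale spectral_resolution = vector_space scale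
  for scale :: "'k::field \<Rightarrow> 'v::ab_group_add \<Rightarrow> 'v" (infixr \<open>*s\<close> 75) +
  fixes d :: nat and A :: "'v \<Rightarrow> 'v" and E :: "nat \<Rightarrow> 'v \<Rightarrow> 'v" and \<theta> :: "nat \<Rightarrow> 'k"
  assumes linear_A: "Vector_Spaces.linear scale scale A"
    and linear_E: "h \<le> d \<Longrightarrow> Vector_Spaces.linear scale scale (E h)"
    and E_E: "h \<le> d \<Longrightarrow> k \<le> d \<Longrightarrow> E h (E k v) = (if h = k then E h v else 0)"
    and sum_E: "(\<Sum>h\<le>d. E h v) = v"
    and A_E: "h \<le> d \<Longrightarrow> A (E h v) = \<theta> h *s E h v"
    and E_nonzero: "h \<le> d \<Longrightarrow> \<exists>v. E h v \<noteq> 0"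
    and inj_\<theta>: "inj_on \<theta> {..d}"
begin

lemmas A_hom = module_hom_linearI[OF linear_A]
lemmas E_hom = module_hom_linearI[OF linear_E]
lemmas A_linear = module_hom.add[OF A_hom] module_hom.scale[OF A_hom] module_hom.diff[OF A_hom]
  module_hom.sum[OF A_hom] module_hom.zero[OF A_hom]
lemmas E_linear = module_hom.add[OF E_hom] module_hom.scale[OF E_hom] module_hom.diff[OF E_hom]
  module_hom.sum[OF E_hom] module_hom.zero[OF E_hom]

lemma coordinates_eqI:
  assumes "\<And>h. h \<le> d \<Longrightarrow> E h u = E h v"
  shows "u = v"
proof -
  have "u = (\<Sum>h\<le>d. E h u)" by (simp only: sum_E)
  also have "\<dots> = (\<Sum>h\<le>d. E h v)" by (rule sum.cong) (simp_all add: assms)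
  also have "\<dots> = v" by (rule sum_E)
  finally show ?thesis .
qed

lemma E_A: "h \<le> d \<Longrightarrow> E h (A v) = \<theta> h *s E h v"
proof -
  assume h: "h \<le> d"
  have "E h (A v) = E h (A (\<Sum>k\<le>d. E k v))" by (simp add: sum_E)
  also have "\<dots> = (\<Sum>k\<le>d. \<theta> k *s E h (E k v))"
    using h by (simp add: A_linear E_linear A_E)
  also have "\<dots> = (\<Sum>k\<le>d. if k = h then \<theta> h *s E h v else 0)"
    using h by (intro sum.cong) (auto simp: E_E)
  finally show ?thesis using h by simp
qed

lemma E_poly_map:
  assumes "h \<le> d"
  shows "E h (poly_map scale p A v) = poly p (\<theta> h) *s E h v"
proof -
  have "E h ((A ^^ k) v) = \<theta> h ^ k *s E h v" for k
    using assms by (induction k) (auto simp: E_A)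
  then have "E h (poly_map scale p A v) = (\<Sum>k\<le>degree p. (coeff p k * \<theta> h ^ k) *s E h v)"
    using assms by (simp add: poly_map_def E_linear atLeast0AtMost)
  then show ?thesis
    by (simp only: poly_altdef scale_sum_left)
qed

lemma poly_map_mult: "poly_map scale (p * q) A v = poly_map scale p A (poly_map scale q A v)"
  by (rule coordinates_eqI) (simp add: E_poly_map)

lemma linear_poly_map: "Vector_Spaces.linear scale scale (poly_map scale p A)"
proof -
  have "poly_map scale p A (u + v) = poly_map scale p A u + poly_map scale p A v" for u v
    by (rule coordinates_eqI) (simp only: E_poly_map E_linear scale_right_distrib)
  moreover have "poly_map scale p A (c *s v) = c *s poly_map scale p A v" for c v
    by (rule coordinates_eqI) (simp only: E_poly_map E_linear scale_scale mult.commute)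
  ultimately show ?thesis
    unfolding Vector_Spaces.linear_iff using vector_space_axioms by blast
qed

lemmas poly_map_hom = module_hom_linearI[OF linear_poly_map]
lemmas poly_map_linear = module_hom.add[OF poly_map_hom] module_hom.scale[OF poly_map_hom]
  module_hom.diff[OF poly_map_hom] module_hom.sum[OF poly_map_hom] module_hom.zero[OF poly_map_hom]

definition spectral_sum :: "nat set \<Rightarrow> 'v set" where
  "spectral_sum I = {v. \<forall>h\<le>d. h \<notin> I \<longrightarrow> E h v = 0}"

lemma sum_ranges_eq_spectral_sum:
  assumes "I \<subseteq> {..d}"
  shows "(\<Sum>h\<in>I. range (E h)) = spectral_sum I"
proof -
  have fin: "finite I" using assms by (rule finite_subset) simp
  show ?thesis
  proof (intro equalityI subsetI)
    fix v assume "v \<in> (\<Sum>h\<in>I. range (E h))"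
    then have "v \<in> {sum s I |s. \<forall>h\<in>I. s h \<in> range (E h)}"
      by (subst (asm) set_sum_alt[OF fin])
    then have "\<exists>s. v = sum s I \<and> (\<forall>h\<in>I. s h \<in> range (E h))"
      by (rule CollectD)
    then obtain s where s: "v = sum s I \<and> (\<forall>h\<in>I. s h \<in> range (E h))"
      by (rule exE)
    have "E k (s h) = 0" if "k \<le> d" "k \<notin> I" "h \<in> I" for k h
    proof -
      have "s h \<in> range (E h)" using s that(3) by (elim conjE bspec)
      then obtain w where w: "s h = E h w" by (rule rangeE)
      have "h \<le> d" "k \<noteq> h" using that assms by auto
      then show ?thesis using that(1) by (simp only: w E_E if_False)
    qed
    then show "v \<in> spectral_sum I"
      by (auto simp: spectral_sum_def conjunct1[OF s] E_linear intro!: sum.neutral)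
  next
    fix v assume v: "v \<in> spectral_sum I"
    have "v = (\<Sum>h\<le>d. E h v)" by (simp add: sum_E)
    also have "\<dots> = (\<Sum>h\<in>I. E h v)"
      using v assms by (intro sum.mono_neutral_right) (auto simp: spectral_sum_def)
    finally have "v \<in> {sum s I |s. \<forall>h\<in>I. s h \<in> range (E h)}"
      by (intro CollectI exI[of _ "\<lambda>h. E h v"] conjI) auto
    then show "v \<in> (\<Sum>h\<in>I. range (E h))"
      by (subst set_sum_alt[OF fin])
  qed
qed

lemma subspace_spectral_sum: "subspace (spectral_sum I)"
  by (rule subspaceI) (auto simp: spectral_sum_def E_linear)

lemma spectral_sum_mono: "I \<inter> {..d} \<subseteq> J \<Longrightarrow> spectral_sum I \<subseteq> spectral_sum J"
  by (auto simp: spectral_sum_def)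

lemma spectral_sum_cong: "I \<inter> {..d} = J \<inter> {..d} \<Longrightarrow> spectral_sum I = spectral_sum J"
  by (intro equalityI spectral_sum_mono) auto

lemma spectral_sum_empty: "I \<inter> {..d} = {} \<Longrightarrow> spectral_sum I = {0}"
proof (intro equalityI subsetI)
  fix v assume I: "I \<inter> {..d} = {}" and v: "v \<in> spectral_sum I"
  have "v = 0"
  proof (rule coordinates_eqI)
    fix h assume "h \<le> d"
    then show "E h v = E h 0" using I v by (auto simp: spectral_sum_def E_linear)
  qed
  then show "v \<in> {0}" by simp
qed (auto simp: spectral_sum_def E_linear)

lemma poly_map_spectral_sum:
  assumes "v \<in> spectral_sum I"
  shows "poly_map scale p A v \<in> spectral_sum (I - {h. poly p (\<theta> h) = 0})"
  using assms by (auto simp: spectral_sum_def E_poly_map)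

lemma shift_spectral_sum:
  "v \<in> spectral_sum I \<Longrightarrow> A v - \<theta> k *s v \<in> spectral_sum (I - {k})"
  by (auto simp: spectral_sum_def E_linear E_A)

text \<open>
  A polynomial without roots among the eigenvalues indexed by \<open>I\<close> acts on the components in \<open>I\<close> by
  nonzero scalars, so dividing by them gives a preimage.
\<close>

lemma poly_map_invertible:
  assumes u: "u \<in> spectral_sum I" and p: "\<And>h. h \<in> I \<Longrightarrow> h \<le> d \<Longrightarrow> poly p (\<theta> h) \<noteq> 0"
  obtains x where "x \<in> spectral_sum I" "poly_map scale p A x = u"
proof
  define x where "x = (\<Sum>h\<le>d. inverse (poly p (\<theta> h)) *s E h u)"
  have x: "E k x = inverse (poly p (\<theta> k)) *s E k u" if "k \<le> d" for k
  proof -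
    have "E k x = (\<Sum>h\<le>d. inverse (poly p (\<theta> h)) *s E k (E h u))"
      using that by (simp add: x_def E_linear)
    also have "\<dots> = (\<Sum>h\<le>d. if h = k then inverse (poly p (\<theta> k)) *s E k u else 0)"
      using that by (intro sum.cong) (auto simp: E_E)
    finally show ?thesis using that by simp
  qed
  show "x \<in> spectral_sum I" using u by (auto simp: spectral_sum_def x)
  show "poly_map scale p A x = u"
  proof (rule coordinates_eqI)
    fix h assume h: "h \<le> d"
    show "E h (poly_map scale p A x) = E h u"
    proof (cases "h \<in> I")
      case True then show ?thesis using h p by (simp add: E_poly_map x)
    next
      case False then show ?thesis using h u by (simp add: E_poly_map x spectral_sum_def)
    qed
  qed
qed

text \<open>
  Vanishing of single blocks \<open>E h B E k\<close> turns into a statement about sums of eigenspaces. This is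
  how the tridiagonal relations are used below.
\<close>

lemma E_map_eq_0:
  assumes B: "Vector_Spaces.linear scale scale B" and v: "v \<in> spectral_sum I" and h: "h \<le> d"
    and blocks: "\<And>k w. k \<in> I \<Longrightarrow> k \<le> d \<Longrightarrow> E h (B (E k w)) = 0"
  shows "E h (B v) = 0"
proof -
  note B_hom = module_hom_linearI[OF B]
  have "E h (B v) = E h (B (\<Sum>k\<le>d. E k v))" by (simp only: sum_E)
  also have "\<dots> = (\<Sum>k\<le>d. E h (B (E k v)))"
    using h by (simp add: module_hom.sum[OF B_hom] E_linear)
  also have "\<dots> = 0"
  proof (rule sum.neutral, rule ballI)
    fix k assume k: "k \<in> {..d}"
    show "E h (B (E k v)) = 0"
    proof (cases "k \<in> I")
      case True
      then show ?thesis using k blocks by simp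
    next
      case False
      then have "E k v = 0" using k v by (simp add: spectral_sum_def)
      then show ?thesis using h by (simp add: module_hom.zero[OF B_hom] E_linear)
    qed
  qed
  finally show ?thesis .
qed

text \<open>
  If an ordering of the eigenspaces is standard, then so is the reversed one; this is the part of that
  symmetry that concerns a single map.
\<close>

lemma reverse:
  "spectral_resolution scale d A (\<lambda>h. E (d - h)) (\<lambda>h. \<theta> (d - h))"
proof (intro spectral_resolution.intro spectral_resolution_axioms.intro vector_space_axioms linear_A)
  show "(\<Sum>h\<le>d. E (d - h) v) = v" for v
  proof -
    have "(\<Sum>h\<le>d. E (d - h) v) = (\<Sum>h\<le>d. E h v)"
      by (rule sum.reindex_bij_witness[of _ "\<lambda>h. d - h" "\<lambda>h. d - h"]) auto
    then show ?thesis by (simp only: sum_E)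
  qed
  show "inj_on (\<lambda>h. \<theta> (d - h)) {..d}"
    by (rule inj_onI) (use inj_onD[OF inj_\<theta>] in fastforce)
  show "E (d - h) (E (d - k) v) = (if h = k then E (d - h) v else 0)"
    if "h \<le> d" "k \<le> d" for h k v
    using that by (simp add: E_E) arith
qed (simp_all add: linear_E A_E E_nonzero)

definition node_poly :: "nat \<Rightarrow> nat \<Rightarrow> 'k poly" where
  "node_poly i j = (\<Prod>h\<in>{i..<j}. [:- \<theta> h, 1:])"

text \<open>
  Away from the degenerate case \<open>j = i - 1\<close>, natural numbers suffice for the second index of \<open>\<tau>\<close>.
\<close>

lemma tau_eq_node_poly: "i \<le> j \<Longrightarrow> tau \<theta> i (int j) = node_poly i j"
  by (simp add: tau_def node_poly_def)

lemma poly_node_poly: "poly (node_poly i j) x = (\<Prod>h\<in>{i..<j}. x - \<theta> h)"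
  by (simp add: node_poly_def poly_prod)

lemma node_poly_mult: "i \<le> j \<Longrightarrow> j \<le> k \<Longrightarrow> node_poly i j * node_poly j k = node_poly i k"
  by (simp add: node_poly_def prod.atLeastLessThan_concat)

lemma node_poly_root: "poly (node_poly i j) (\<theta> h) = 0" if "h \<in> {i..<j}"
  using that by (auto simp: poly_node_poly)

lemma node_poly_nonzero: "poly (node_poly i j) (\<theta> h) \<noteq> 0" if "j \<le> h" "h \<le> d"
  using that by (auto simp: poly_node_poly dest: inj_onD[OF inj_\<theta>])

lemma node_map_refl: "poly_map scale (node_poly i i) A v = v"
  by (rule coordinates_eqI) (simp add: E_poly_map node_poly_def)

lemma node_map_compose:
  "i \<le> j \<Longrightarrow> j \<le> k \<Longrightarrow>
    poly_map scale (node_poly j k) A (poly_map scale (node_poly i j) A v) =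
    poly_map scale (node_poly i k) A v"
  by (simp add: poly_map_mult[symmetric] node_poly_mult mult.commute)

lemma node_map_Suc:
  "i \<le> j \<Longrightarrow> poly_map scale (node_poly i (Suc j)) A v =
    A (poly_map scale (node_poly i j) A v) - \<theta> j *s poly_map scale (node_poly i j) A v"
  by (rule coordinates_eqI)
    (simp add: E_poly_map E_linear E_A poly_node_poly algebra_simps)

end

text \<open>
  Diagonalizability gives the resolution of the identity: the sum of the idempotents fixes every
  eigenvector, and the eigenvectors span. The eigenvalues are distinct because different
  indices belong to different eigenspaces.
\<close>

lemma spectral_resolution_of_ordering:
  assumes "vector_space scale"
    and lin: "Vector_Spaces.linear scale scale A" and diag: "diagonalizable scale A"
    and E: "bij_betw E {0..d} {P. primitive_idempotent scale A P}"
    and W: "bij_betw (\<lambda>i. range (E i)) {0..d} (eigenspaces scale A)"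
  shows "spectral_resolution scale d A E (\<lambda>i. eigenvalue_on scale A (range (E i)))"
proof -
  interpret vector_space scale by fact
  have prim: "primitive_idempotent scale A (E h)" if "h \<le> d" for h
    using bij_betwE[OF E] that by auto
  have linE: "Vector_Spaces.linear scale scale (E h)" if "h \<le> d" for h
    using prim[OF that] by (simp add: primitive_idempotent_def)
  have inj: "range (E h) \<noteq> range (E k)" if "h \<le> d" "k \<le> d" "h \<noteq> k" for h k
    using bij_betw_imp_inj_on[OF W] that by (auto simp: inj_on_def)
  have eig: "range (E h) \<in> eigenspaces scale A" if "h \<le> d" for h
    using bij_betwE[OF W] that by auto
  have EE: "E h (E k v) = (if h = k then E h v else 0)" if hk: "h \<le> d" "k \<le> d" for h k v
  proof -
    obtain W where W: "range (E h) = W" "\<forall>v\<in>W. E h v = v"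
        "\<forall>W'\<in>eigenspaces scale A - {W}. \<forall>v\<in>W'. E h v = 0"
      using prim[OF hk(1)] unfolding primitive_idempotent_def by (elim conjE bexE)
    show ?thesis
    proof (cases "h = k")
      case True
      have "E h v \<in> W" unfolding W(1)[symmetric] by (rule rangeI)
      then show ?thesis using W(2) True by simp
    next
      case False
      have "range (E k) \<in> eigenspaces scale A - {W}"
        using eig[OF hk(2)] inj[OF hk False] W(1) by simp
      then have "E h (E k v) = 0" by (rule W(3)[THEN bspec, THEN bspec, OF _ rangeI])
      then show ?thesis using False by simp
    qed
  qed
  define \<theta> where "\<theta> = (\<lambda>i. eigenvalue_on scale A (range (E i)))"
  have \<theta>: "range (E h) = eigenspace scale A (\<theta> h) \<and> eigenspace scale A (\<theta> h) \<noteq> {0}"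
    if h: "h \<le> d" for h
  proof -
    obtain t where t: "range (E h) = eigenspace scale A t" "eigenspace scale A t \<noteq> {0}"
      using eig[OF h] unfolding eigenspaces_def by blast
    have "0 \<in> range (E h)"
      using module_hom.zero[OF module_hom_linearI[OF linE[OF h]]] by (metis rangeI)
    then obtain w where w: "w \<in> range (E h)" "w \<noteq> 0"
      using t by (metis subset_singletonD subsetI insertI1 empty_iff)
    have "eigenvalue_on scale A (range (E h)) = t"
      unfolding eigenvalue_on_def
    proof (rule the_equality)
      show "\<forall>v\<in>range (E h). A v = scale t v" using t by (auto simp: eigenspace_def)
      fix s assume "\<forall>v\<in>range (E h). A v = scale s v"
      then have "scale s w = scale t w" using w t by (auto simp: eigenspace_def)
      then show "s = t" using w by simp
    qed
    then show ?thesis using t by (simp add: \<theta>_def)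
  qed
  have sumE: "(\<Sum>h\<le>d. E h v) = v" for v
  proof -
    obtain B where B: "span B = UNIV" "independent B" "\<forall>b\<in>B. \<exists>t. A b = scale t b"
      using diag by (auto simp: diagonalizable_def)
    have homE: "module_hom scale scale (E h)" if "h \<le> d" for h
      using linE[OF that] by (rule module_hom_linearI)
    have basis: "(\<Sum>h\<le>d. E h b) = b" if b: "b \<in> B" for b
    proof -
      obtain t where t: "A b = scale t b" using B(3) b by blast
      have "b \<noteq> 0" using B(2) b dependent_zero by blast
      then have "eigenspace scale A t \<in> eigenspaces scale A"
        using t by (auto simp: eigenspaces_def eigenspace_def)
      then obtain k where k: "k \<le> d" "eigenspace scale A t = range (E k)"
        unfolding bij_betw_imp_surj_on[OF W, symmetric] by auto
      have "b \<in> range (E k)" by (simp add: k(2)[symmetric] eigenspace_def t)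
      then obtain w where w: "b = E k w" by (rule rangeE)
      have "(\<Sum>h\<le>d. E h b) = (\<Sum>h\<le>d. if h = k then b else 0)"
        using k(1) by (intro sum.cong) (auto simp: w EE)
      then show ?thesis using k(1) by simp
    qed
    have "v \<in> span B" by (simp add: B(1))
    then show ?thesis
    proof (induction rule: span_induct_alt)
      case base
      then show ?case by (simp add: module_hom.zero[OF homE])
    next
      case (step c x y)
      have "(\<Sum>h\<le>d. E h (scale c x + y)) = scale c (\<Sum>h\<le>d. E h x) + (\<Sum>h\<le>d. E h y)"
        by (simp add: module_hom.add[OF homE] module_hom.scale[OF homE] sum.distrib
            scale_sum_right)
      then show ?case by (simp only: basis[OF step(1)] step(2))
    qed
  qed
  have "inj_on \<theta> {..d}"
    using \<theta> inj by (intro inj_onI) (metis atMost_iff)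
  moreover have "A (E h v) = scale (\<theta> h) (E h v)" if "h \<le> d" for h v
  proof -
    have "E h v \<in> range (E h)" by (rule rangeI)
    then show ?thesis using \<theta>[OF that] by (simp add: eigenspace_def)
  qed
  moreover have "\<exists>v. E h v \<noteq> 0" if "h \<le> d" for h
  proof (rule ccontr)
    assume "\<nexists>v. E h v \<noteq> 0"
    then have "range (E h) = {0}" by auto
    then show False using \<theta>[OF that] by simp
  qed
  ultimately have "spectral_resolution scale d A E \<theta>"
    by (intro spectral_resolution.intro spectral_resolution_axioms.intro
        lin linE EE sumE vector_space_axioms)
  then show ?thesis by (simp add: \<theta>_def)
qed


section \<open>The split decomposition\<close>

text \<open>
  The two conditions on blocks express the tridiagonal relations without reference to sums of
  eigenspaces. In this form they are visibly invariant under reversal of either ordering.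
\<close>

locale tridiagonal_system =
  primal: spectral_resolution scale d A E \<theta> + dual: spectral_resolution scale d As Es \<theta>s
  for scale :: "'k::field \<Rightarrow> 'v::ab_group_add \<Rightarrow> 'v" (infixr \<open>*s\<close> 75)
    and d :: nat and A :: "'v \<Rightarrow> 'v" and As :: "'v \<Rightarrow> 'v"
    and E :: "nat \<Rightarrow> 'v \<Rightarrow> 'v" and Es :: "nat \<Rightarrow> 'v \<Rightarrow> 'v"
    and \<theta> :: "nat \<Rightarrow> 'k" and \<theta>s :: "nat \<Rightarrow> 'k" +
  assumes tridiagonal: "h \<le> d \<Longrightarrow> k \<le> d \<Longrightarrow> h + 1 < k \<or> k + 1 < h \<Longrightarrow> E h (As (E k v)) = 0"
    and dual_tridiagonal:
      "h \<le> d \<Longrightarrow> k \<le> d \<Longrightarrow> h + 1 < k \<or> k + 1 < h \<Longrightarrow> Es h (A (Es k v)) = 0"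
    and irreducible: "primal.subspace W \<Longrightarrow> A ` W \<subseteq> W \<Longrightarrow> As ` W \<subseteq> W \<Longrightarrow> W = {0} \<or> W = UNIV"
begin

text \<open>
  The second parameter makes room for the spaces with \<open>a < b\<close>. Their vanishing is what makes the split
  decomposition direct. An index beyond \<open>d\<close> is harmless: the first factor
  is then everything, or the second is zero.
\<close>

definition split_space :: "nat \<Rightarrow> nat \<Rightarrow> 'v set" where
  "split_space a b = dual.spectral_sum {..a} \<inter> primal.spectral_sum {b..}"

abbreviation U :: "nat \<Rightarrow> 'v set" where "U i \<equiv> split_space i i"

definition K :: "nat \<Rightarrow> 'v set" where
  "K i = dual.spectral_sum {..i} \<inter> primal.spectral_sum {i..d - i}"

lemma subspace_split_space: "primal.subspace (split_space a b)"
  unfolding split_space_def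
  by (intro primal.subspace_inter primal.subspace_spectral_sum dual.subspace_spectral_sum)

lemma A_dual_sum: "v \<in> dual.spectral_sum {..a} \<Longrightarrow> A v \<in> dual.spectral_sum {..Suc a}"
  unfolding dual.spectral_sum_def[of "{..Suc a}"]
  by (auto intro!: dual.E_map_eq_0[OF primal.linear_A] dual_tridiagonal)

lemma As_primal_sum: "v \<in> primal.spectral_sum {Suc b..} \<Longrightarrow> As v \<in> primal.spectral_sum {b..}"
  unfolding primal.spectral_sum_def[of "{b..}"]
  by (auto intro!: primal.E_map_eq_0[OF dual.linear_A] tridiagonal)

text \<open>
  Subtracting the eigenvalue kills the extreme component in one ordering, while the tridiagonal
  relation lets the vector spread by only one step in the other ordering. The map \<open>As\<close> moves in the
  opposite direction for the same reason.
\<close>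

lemma raise:
  assumes "v \<in> split_space a b"
  shows "A v - \<theta> b *s v \<in> split_space (Suc a) (Suc b)"
proof -
  have X: "v \<in> dual.spectral_sum {..a}" and Y: "v \<in> primal.spectral_sum {b..}"
    using assms by (auto simp: split_space_def)
  have "v \<in> dual.spectral_sum {..Suc a}"
    by (rule subsetD[OF dual.spectral_sum_mono X]) auto
  then have "A v - \<theta> b *s v \<in> dual.spectral_sum {..Suc a}"
    by (intro primal.subspace_diff primal.subspace_scale dual.subspace_spectral_sum
        A_dual_sum X)
  moreover have "{b..} - {b} = {Suc b..}" by auto
  then have "A v - \<theta> b *s v \<in> primal.spectral_sum {Suc b..}"
    using primal.shift_spectral_sum[OF Y, of b] by simp
  ultimately show ?thesis by (simp add: split_space_def)
qed

lemma lower: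
  assumes "v \<in> split_space (Suc a) (Suc b)"
  shows "As v - \<theta>s (Suc a) *s v \<in> split_space a b"
proof -
  have X: "v \<in> dual.spectral_sum {..Suc a}" and Y: "v \<in> primal.spectral_sum {Suc b..}"
    using assms by (auto simp: split_space_def)
  have "v \<in> primal.spectral_sum {b..}"
    by (rule subsetD[OF primal.spectral_sum_mono Y]) auto
  then have "As v - \<theta>s (Suc a) *s v \<in> primal.spectral_sum {b..}"
    by (intro primal.subspace_diff primal.subspace_scale primal.subspace_spectral_sum
        As_primal_sum Y)
  moreover have "{..Suc a} - {Suc a} = {..a}" by auto
  then have "As v - \<theta>s (Suc a) *s v \<in> dual.spectral_sum {..a}"
    using dual.shift_spectral_sum[OF X, of "Suc a"] by simp
  ultimately show ?thesis by (simp add: split_space_def)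
qed

lemma lower_0:
  assumes "v \<in> split_space 0 b"
  shows "As v = \<theta>s 0 *s v"
proof -
  have "As v - \<theta>s 0 *s v \<in> dual.spectral_sum ({..0} - {0})"
    using assms by (intro dual.shift_spectral_sum) (simp add: split_space_def)
  also have "\<dots> = {0}" by (rule dual.spectral_sum_empty) simp
  finally show ?thesis by simp
qed

text \<open>
  Along a diagonal of the family, \<open>A\<close> moves each space into itself plus the next one and \<open>As\<close> moves it
  into itself plus the previous one, so the span is invariant under both.
\<close>

lemma diagonal_span_trivial:
  defines "W r \<equiv> primal.span (\<Union>a. split_space a (a + r))"
  shows "W r = {0} \<or> W r = UNIV"
proof (rule irreducible)
  have gen: "v \<in> W r" if "v \<in> split_space a (a + r)" for v a
    unfolding W_def by (rule primal.span_base) (use that in blast)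
  have sub: "primal.subspace (W r)" unfolding W_def by (rule primal.subspace_span)
  show "primal.subspace (W r)" by (rule sub)
  show "A ` W r \<subseteq> W r"
  proof (rule image_subsetI)
    fix v assume "v \<in> W r"
    then show "A v \<in> W r"
      unfolding W_def[of r]
    proof (induction rule: primal.span_induct_alt)
      case base
      then show ?case by (simp add: primal.A_linear primal.span_zero)
    next
      case (step c x y)
      then obtain a where x: "x \<in> split_space a (a + r)" by blast
      have "A x - \<theta> (a + r) *s x \<in> W r"
        using raise[OF x] gen[of _ "Suc a"] by simp
      then have "A x \<in> W r"
        using primal.subspace_add[OF sub _ primal.subspace_scale[OF sub gen[OF x]]]
        by (metis diff_add_cancel)
      then show ?case
        using step by (simp add: W_def primal.A_linear primal.span_add primal.span_scale)
    qed
  qed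
  show "As ` W r \<subseteq> W r"
  proof (rule image_subsetI)
    fix v assume "v \<in> W r"
    then show "As v \<in> W r"
      unfolding W_def[of r]
    proof (induction rule: primal.span_induct_alt)
      case base
      then show ?case by (simp add: dual.A_linear primal.span_zero)
    next
      case (step c x y)
      then obtain a where x: "x \<in> split_space a (a + r)" by blast
      have "As x \<in> W r"
      proof (cases a)
        case 0
        then have "As x = \<theta>s 0 *s x" using x lower_0 by simp
        then show ?thesis using primal.subspace_scale[OF sub gen[OF x]] by simp
      next
        case (Suc b)
        then have "As x - \<theta>s a *s x \<in> W r"
          using lower[of x b "b + r"] x gen[of _ b] by simp
        then show ?thesis
          using primal.subspace_add[OF sub _ primal.subspace_scale[OF sub gen[OF x]]]
          by (metis diff_add_cancel)
      qed
      then show ?case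
        using step by (simp add: W_def dual.A_linear primal.span_add primal.span_scale)
    qed
  qed
qed

text \<open>
  For \<open>a < b\<close> every space on the diagonal lies in the sum of the eigenspaces of \<open>A\<close> with index at
  least 1, so the span is not the whole space.
\<close>

lemma split_space_eq_0:
  assumes "a < b"
  shows "split_space a b = {0}"
proof -
  define r where "r = b - a"
  have r: "b = a + r" "r \<ge> 1" using assms by (auto simp: r_def)
  let ?W = "primal.span (\<Union>a. split_space a (a + r))"
  have "(\<Union>a. split_space a (a + r)) \<subseteq> primal.spectral_sum {1..}"
  proof (rule UN_least)
    fix a
    have "primal.spectral_sum {a + r..} \<subseteq> primal.spectral_sum {1..}"
      using r by (intro primal.spectral_sum_mono) auto
    then show "split_space a (a + r) \<subseteq> primal.spectral_sum {1..}"
      by (auto simp: split_space_def)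
  qed
  then have W: "?W \<subseteq> primal.spectral_sum {1..}"
    by (rule primal.span_minimal) (rule primal.subspace_spectral_sum)
  obtain v where "E 0 v \<noteq> 0" using primal.E_nonzero by blast
  then have "E 0 v \<notin> primal.spectral_sum {1..}"
    by (auto simp: primal.spectral_sum_def primal.E_E)
  then have "?W = {0}" using W diagonal_span_trivial[of r] by blast
  then have "split_space a b \<subseteq> {0}"
    unfolding r(1) by (metis UN_upper UNIV_I primal.span_superset order_trans)
  then show ?thesis using primal.subspace_0[OF subspace_split_space] by blast
qed

text \<open>
  On the main diagonal the span contains the range of \<open>Es 0\<close>, so it is not zero.
\<close>

lemma span_U: "primal.span (\<Union>a. U a) = UNIV"
proof -
  obtain v where v: "Es 0 v \<noteq> 0" using dual.E_nonzero by blast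
  have "Es 0 v \<in> U 0"
    by (auto simp: split_space_def dual.spectral_sum_def primal.spectral_sum_def dual.E_E)
  then have "Es 0 v \<in> primal.span (\<Union>a. U a)"
    by (intro primal.span_base) blast
  then show ?thesis using v diagonal_span_trivial[of 0] by auto
qed

lemma split_decomposition:
  obtains x y where "x \<in> primal.span (\<Union>h\<le>i. U h)" "y \<in> primal.spectral_sum {Suc i..}" "v = x + y"
proof -
  have "{..i} \<union> {Suc i..} = UNIV" by auto
  then have "(\<Union>a. U a) = (\<Union>h\<le>i. U h) \<union> (\<Union>h\<in>{Suc i..}. U h)"
    by (metis UN_Un)
  then have "v \<in> primal.span ((\<Union>h\<le>i. U h) \<union> (\<Union>h\<in>{Suc i..}. U h))"
    using span_U by simp
  then obtain x y where xy: "x \<in> primal.span (\<Union>h\<le>i. U h)"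
      "y \<in> primal.span (\<Union>h\<in>{Suc i..}. U h)" "v = x + y"
    unfolding primal.span_Un by blast
  have "(\<Union>h\<in>{Suc i..}. U h) \<subseteq> primal.spectral_sum {Suc i..}"
  proof (rule UN_least)
    fix h assume "h \<in> {Suc i..}"
    then have "primal.spectral_sum {h..} \<subseteq> primal.spectral_sum {Suc i..}"
      by (intro primal.spectral_sum_mono) auto
    then show "U h \<subseteq> primal.spectral_sum {Suc i..}" by (auto simp: split_space_def)
  qed
  then have "primal.span (\<Union>h\<in>{Suc i..}. U h) \<subseteq> primal.spectral_sum {Suc i..}"
    by (rule primal.span_minimal) (rule primal.subspace_spectral_sum)
  then show thesis using xy that by blast
qed

text \<open>
  Of a vector in \<open>dual.spectral_sum {..i}\<close>, the part that comes from the spaces \<open>U h\<close> with \<open>h > i\<close>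
  lies in \<open>split_space i (i + 1)\<close>, which is zero.
\<close>

lemma span_initial_U: "primal.span (\<Union>h\<le>i. U h) = dual.spectral_sum {..i}"
proof (rule equalityI)
  have "(\<Union>h\<le>i. U h) \<subseteq> dual.spectral_sum {..i}"
  proof (rule UN_least)
    fix h assume "h \<in> {..i}"
    then have "dual.spectral_sum {..h} \<subseteq> dual.spectral_sum {..i}"
      by (intro dual.spectral_sum_mono) auto
    then show "U h \<subseteq> dual.spectral_sum {..i}" by (auto simp: split_space_def)
  qed
  then show sub: "primal.span (\<Union>h\<le>i. U h) \<subseteq> dual.spectral_sum {..i}"
    by (rule primal.span_minimal) (rule dual.subspace_spectral_sum)
  show "dual.spectral_sum {..i} \<subseteq> primal.span (\<Union>h\<le>i. U h)"
  proof
    fix v assume v: "v \<in> dual.spectral_sum {..i}"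
    obtain x y where xy: "x \<in> primal.span (\<Union>h\<le>i. U h)" "y \<in> primal.spectral_sum {Suc i..}"
        "v = x + y"
      by (rule split_decomposition)
    have "y = v - x" using xy by simp
    then have "y \<in> dual.spectral_sum {..i}"
      using xy v sub primal.subspace_diff[OF dual.subspace_spectral_sum] by blast
    then have "y \<in> split_space i (Suc i)" using xy by (simp add: split_space_def)
    then show "v \<in> primal.span (\<Union>h\<le>i. U h)" using xy by (simp add: split_space_eq_0)
  qed
qed

text \<open>
  This is the split decomposition for the ordering \<open>E d, \<dots>, E 0\<close>, cut after index \<open>i\<close>. The spaces
  \<open>dual.spectral_sum {..i}\<close> do not change when the other ordering is reversed.
\<close>

lemma reversed_decomposition:
  assumes "i \<le> d"
  obtains x y where "x \<in> dual.spectral_sum {..i}" "y \<in> primal.spectral_sum {..<d - i}" "v = x + y"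
proof -
  interpret rev: tridiagonal_system scale d A As "\<lambda>h. E (d - h)" Es "\<lambda>h. \<theta> (d - h)" \<theta>s
  proof (intro tridiagonal_system.intro tridiagonal_system_axioms.intro primal.reverse
      dual.spectral_resolution_axioms)
    show "E (d - h) (As (E (d - k) v)) = 0" if "h \<le> d" "k \<le> d" "h + 1 < k \<or> k + 1 < h" for h k v
      using that by (intro tridiagonal) auto
  qed (use dual_tridiagonal irreducible in auto)
  obtain x y where xy: "x \<in> dual.spectral_sum {..i}" "y \<in> rev.primal.spectral_sum {Suc i..}" "v = x + y"
    using rev.split_decomposition[of i v] unfolding rev.span_initial_U by blast
  have "E h y = 0" if "h \<le> d" "d - i \<le> h" for h
  proof -
    have "d - h \<le> d" "d - h \<notin> {Suc i..}" using that assms by auto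
    then have "E (d - (d - h)) y = 0"
      using xy(2) unfolding rev.primal.spectral_sum_def by blast
    then show ?thesis using that by (simp only: diff_diff_cancel)
  qed
  then have "y \<in> primal.spectral_sum {..<d - i}"
    by (auto simp: primal.spectral_sum_def)
  then show thesis using xy that by blast
qed

section \<open>Raising strings\<close>

abbreviation node_map :: "nat \<Rightarrow> nat \<Rightarrow> 'v \<Rightarrow> 'v" where
  "node_map i j \<equiv> poly_map scale (primal.node_poly i j) A"

lemma node_map_U: "i \<le> j \<Longrightarrow> v \<in> U i \<Longrightarrow> node_map i j v \<in> U j"
proof (induction j rule: dec_induct)
  case base
  then show ?case by (simp add: primal.node_map_refl)
next
  case (step j)
  then show ?case using raise[of "node_map i j v" j j] by (simp add: primal.node_map_Suc)
qed

text \<open>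
  A preimage of \<open>u\<close> under the longer product \<open>node_map 0 m\<close> is easy to find, since its roots differ
  from the eigenvalues that occur in \<open>u\<close>, and it may be changed by anything in the kernel of that product.
  The reversed decomposition uses this freedom to move it into the span of \<open>U 0, \<dots>, U i\<close>. On each of
  these spaces the longer product factors through \<open>node_map i m\<close> up to terms beyond index \<open>m\<close>, and
  the latter are excluded by \<open>split_space_eq_0\<close>.
\<close>

lemma node_map_surjective:
  assumes i: "2 * i \<le> d" and u: "u \<in> U (d - i)"
  obtains w where "w \<in> U i" "node_map i (d - i) w = u"
proof -
  define m where "m = d - i"
  have m: "i \<le> m" "m \<le> d" "i \<le> d" "m = d - i" using i by (auto simp: m_def)
  note [simp] = primal.poly_map_linear
  have "u \<in> primal.spectral_sum {m..}" using u by (simp add: m_def split_space_def)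
  then obtain x where x: "node_map 0 m x = u"
    by (rule primal.poly_map_invertible[of u _ "primal.node_poly 0 m"])
      (simp_all add: primal.node_poly_nonzero)
  obtain y z where yz: "y \<in> dual.spectral_sum {..i}" "z \<in> primal.spectral_sum {..<m}" "x = y + z"
    using reversed_decomposition[OF m(3), of x] m(4) by metis
  have "node_map 0 m z \<in> primal.spectral_sum ({..<m} - {h. poly (primal.node_poly 0 m) (\<theta> h) = 0})"
    using yz(2) by (rule primal.poly_map_spectral_sum)
  also have "\<dots> = {0}"
    by (rule primal.spectral_sum_empty) (auto simp: primal.node_poly_root)
  finally have y: "node_map 0 m y = u" using x yz(3) by simp
  have "y \<in> primal.span (\<Union>h\<le>i. U h)" using yz(1) by (simp add: span_initial_U)
  then have "\<exists>w\<in>U i. node_map 0 m y - node_map i m w \<in> primal.spectral_sum {Suc m..}"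
  proof (induction rule: primal.span_induct_alt)
    case base
    have "0 \<in> U i" by (rule primal.subspace_0[OF subspace_split_space])
    then show ?case
      by (intro bexI[of _ 0])
        (simp_all add: primal.subspace_0[OF primal.subspace_spectral_sum])
  next
    case (step c p q)
    then obtain h where h: "h \<le> i" "p \<in> U h" by blast
    from step obtain w where w: "w \<in> U i"
        "node_map 0 m q - node_map i m w \<in> primal.spectral_sum {Suc m..}"
      by blast
    \<comment> \<open>Modulo components beyond \<open>m\<close>, the leading factors of \<open>node_map 0 m\<close> act by their value at
      \<open>\<theta> m\<close>, because \<open>node_map h m p\<close> has no component below \<open>m\<close>.\<close>
    define b where "b = poly (primal.node_poly 0 h) (\<theta> m)"
    define w' where "w' = b *s node_map h i p"
    have w': "w' \<in> U i"
      unfolding w'_def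
      by (intro primal.subspace_scale[OF subspace_split_space] node_map_U h)
    have "node_map i m w' = b *s node_map h m p"
      using h(1) m(1) by (simp add: w'_def primal.node_map_compose)
    moreover have "E k (node_map 0 m p - b *s node_map h m p) = 0" if k: "k \<le> d" "k \<le> m" for k
    proof -
      have eq: "E k (node_map 0 m p - b *s node_map h m p)
          = (poly (primal.node_poly 0 m) (\<theta> k) - b * poly (primal.node_poly h m) (\<theta> k)) *s E k p"
        using k(1) by (simp add: primal.E_linear primal.E_poly_map primal.scale_left_diff_distrib)
      consider "k < h" | "h \<le> k" "k < m" | "k = m" using k by linarith
      then show ?thesis
      proof cases
        case 1
        then have "E k p = 0"
          using h(2) k(1) by (simp add: split_space_def primal.spectral_sum_def)
        then show ?thesis by (simp add: eq)
      next
        case 2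
        then show ?thesis by (simp add: eq primal.node_poly_root)
      next
        case 3
        have "poly (primal.node_poly 0 m) (\<theta> m) = b * poly (primal.node_poly h m) (\<theta> m)"
          using primal.node_poly_mult[of 0 h m] h(1) m(1)
          by (simp add: b_def flip: poly_mult)
        then show ?thesis by (simp add: eq[unfolded 3] 3)
      qed
    qed
    ultimately have p: "node_map 0 m p - node_map i m w' \<in> primal.spectral_sum {Suc m..}"
      by (simp add: primal.spectral_sum_def)
    have "node_map 0 m (c *s p + q) - node_map i m (c *s w' + w)
        = c *s (node_map 0 m p - node_map i m w') + (node_map 0 m q - node_map i m w)"
      by (simp add: primal.scale_right_diff_distrib)
    also have "\<dots> \<in> primal.spectral_sum {Suc m..}"
      by (intro primal.subspace_add primal.subspace_scale primal.subspace_spectral_sum p w(2))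
    finally show ?case
      using w(1) w' primal.subspace_add[OF subspace_split_space]
        primal.subspace_scale[OF subspace_split_space] by blast
  qed
  then obtain w where w: "w \<in> U i" "u - node_map i m w \<in> primal.spectral_sum {Suc m..}"
    using y by blast
  have "u - node_map i m w \<in> U m"
    using u w(1) m by (intro primal.subspace_diff[OF subspace_split_space] node_map_U) auto
  then have "u - node_map i m w \<in> split_space m (Suc m)"
    using w(2) by (simp add: split_space_def)
  then have "u = node_map i m w" by (simp add: split_space_eq_0)
  then show thesis using w(1) that m(4) by simp
qed

text \<open>
  The bound \<open>h + j \<le> d\<close> says that the string that starts in \<open>K h\<close> ends at index \<open>d - h\<close>, as it
  does in the decomposition by which \<open>\<Psi>\<close> is defined.
\<close>

definition string_vectors :: "nat \<Rightarrow> 'v set" where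
  "string_vectors j = {node_map h j v | h v. h \<le> j \<and> h + j \<le> d \<and> v \<in> K h}"

lemma node_map_string_span:
  assumes jl: "j \<le> l" "j + l \<le> d" and w: "w \<in> primal.span (string_vectors j)"
  shows "node_map j l w \<in> primal.span (string_vectors l)"
  using w
proof (induction rule: primal.span_induct_alt)
  case base
  then show ?case by (simp add: primal.poly_map_linear primal.span_zero)
next
  case (step c x y)
  then obtain h v where x: "x = node_map h j v" "h \<le> j" "v \<in> K h"
    by (auto simp: string_vectors_def)
  have "node_map j l x = node_map h l v" using x jl by (simp add: primal.node_map_compose)
  moreover have "h \<le> l" "h + l \<le> d" using x jl by auto
  ultimately have "node_map j l x \<in> string_vectors l"
    using x(3) by (auto simp: string_vectors_def)
  then show ?case
    using step by (simp add: primal.poly_map_linear primal.span_add primal.span_scale primal.span_base)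
qed

text \<open>
  Induction along the lower half. A vector of \<open>U (j + 1)\<close> is corrected by the image of some \<open>w \<in> U j\<close> so
  that the difference is killed by \<open>node_map (j + 1) (d - j)\<close>. Such a difference has no
  components from \<open>d - j\<close> on, so it lies in \<open>K (j + 1)\<close>.
\<close>

lemma U_subset_string_span_lower:
  "2 * j \<le> d \<Longrightarrow> U j \<subseteq> primal.span (string_vectors j)"
proof (induction j)
  case 0
  have "primal.spectral_sum {0..} = primal.spectral_sum {0..d}"
    by (rule primal.spectral_sum_cong) auto
  then have "U 0 = K 0" by (simp add: split_space_def K_def)
  then have "U 0 \<subseteq> string_vectors 0"
    using primal.node_map_refl by (force simp: string_vectors_def)
  then show ?case using primal.span_superset by blast
next
  case (Suc j)
  show ?case
  proof
    fix u assume u: "u \<in> U (Suc j)"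
    have j: "2 * j \<le> d" "Suc j \<le> d - j" using Suc.prems by auto
    have "node_map (Suc j) (d - j) u \<in> U (d - j)" using j u by (intro node_map_U)
    then obtain w where w: "w \<in> U j" "node_map j (d - j) w = node_map (Suc j) (d - j) u"
      by (rule node_map_surjective[OF j(1)])
    define k where "k = u - node_map j (Suc j) w"
    have kU: "k \<in> U (Suc j)"
      unfolding k_def using u w by (intro primal.subspace_diff[OF subspace_split_space] node_map_U) auto
    have "node_map (Suc j) (d - j) k = 0"
      using w(2) j by (simp add: k_def primal.poly_map_linear primal.node_map_compose)
    then have "poly (primal.node_poly (Suc j) (d - j)) (\<theta> h) *s E h k = 0" if "h \<le> d" for h
      using that primal.E_poly_map[OF that, of "primal.node_poly (Suc j) (d - j)" k]
      by (simp add: primal.E_linear)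
    then have "E h k = 0" if "h \<le> d" "d - j \<le> h" for h
      using that primal.node_poly_nonzero[of "d - j" h "Suc j"] by auto
    then have "k \<in> K (Suc j)"
      using kU by (auto simp: K_def split_space_def primal.spectral_sum_def not_le)
    then have "node_map (Suc j) (Suc j) k \<in> string_vectors (Suc j)"
      using Suc.prems unfolding string_vectors_def by fastforce
    then have "k \<in> primal.span (string_vectors (Suc j))"
      by (simp add: primal.node_map_refl primal.span_base)
    moreover have "node_map j (Suc j) w \<in> primal.span (string_vectors (Suc j))"
      using Suc w(1) by (intro node_map_string_span) auto
    ultimately have "k + node_map j (Suc j) w \<in> primal.span (string_vectors (Suc j))"
      by (rule primal.span_add)
    then show "u \<in> primal.span (string_vectors (Suc j))" by (simp add: k_def)
  qed
qed

text \<open>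
  In the upper half, \<open>U j\<close> is the image of its mirror image \<open>U (d - j)\<close>, and strings map to strings.
\<close>

lemma U_subset_string_span:
  assumes "j \<le> d"
  shows "U j \<subseteq> primal.span (string_vectors j)"
proof (cases "2 * j \<le> d")
  case True
  then show ?thesis by (rule U_subset_string_span_lower)
next
  case False
  show ?thesis
  proof
    fix u assume "u \<in> U j"
    moreover have i: "2 * (d - j) \<le> d" "d - (d - j) = j" using False assms by auto
    ultimately obtain w where w: "w \<in> U (d - j)" "node_map (d - j) j w = u"
      using node_map_surjective[of "d - j" u] by auto
    have "node_map (d - j) j w \<in> primal.span (string_vectors j)"
      using False assms U_subset_string_span_lower[OF i(1)] w(1)
      by (intro node_map_string_span) auto
    then show "u \<in> primal.span (string_vectors j)" by (simp add: w(2))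
  qed
qed

lemma K_subset_U: "K i \<subseteq> U i"
  using primal.spectral_sum_mono[of "{i..d - i}" "{i..}"]
  by (auto simp: K_def split_space_def)

text \<open>
  A map that lowers each string by one step takes the vectors of the strings at index \<open>j\<close>, which span
  \<open>U j\<close>, to vectors at index \<open>j - 1\<close>. At the start of a string the lowered vector is zero by the
  convention for \<open>\<tau>\<close>.
\<close>

lemma lowering_map_on_U:
  assumes lin: "Vector_Spaces.linear scale scale \<Psi>"
    and \<Psi>: "\<And>i j v. i \<le> j \<Longrightarrow> i + j \<le> d \<Longrightarrow> v \<in> K i \<Longrightarrow>
      \<Psi> (node_map i j v) = c i j *s poly_map scale (tau \<theta> i (int j - 1)) A v"
    and j: "j \<le> d" and u: "u \<in> U j"
  shows "\<Psi> u \<in> (if j = 0 then {0} else U (j - 1))"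
proof -
  define T where "T = (if j = 0 then {0} else U (j - 1))"
  have T: "primal.subspace T"
    by (simp add: T_def subspace_split_space primal.subspace_single_0)
  note hom = module_hom_linearI[OF lin]
  have gen: "\<Psi> x \<in> T" if x: "x \<in> string_vectors j" for x
  proof -
    obtain h v where h: "x = node_map h j v" "h \<le> j" "h + j \<le> d" "v \<in> K h"
      using x by (auto simp: string_vectors_def)
    have "poly_map scale (tau \<theta> h (int j - 1)) A v \<in> T"
    proof (cases "h = j")
      case True
      then have "poly_map scale (tau \<theta> h (int j - 1)) A v = 0"
        by (simp add: tau_def poly_map_def)
      then show ?thesis using primal.subspace_0[OF T] by simp
    next
      case False
      then have le: "h \<le> j - 1" "j \<noteq> 0" using h by auto
      then have int_eq: "int j - 1 = int (j - 1)" by simp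
      have "tau \<theta> h (int j - 1) = primal.node_poly h (j - 1)"
        unfolding int_eq by (rule primal.tau_eq_node_poly[OF le(1)])
      then show ?thesis
        using node_map_U[OF le(1)] K_subset_U h(4) le(2) by (auto simp: T_def)
    qed
    then show ?thesis
      unfolding h(1) \<Psi>[OF h(2-4)] by (rule primal.subspace_scale[OF T])
  qed
  have "u \<in> primal.span (string_vectors j)"
    using U_subset_string_span[OF j] u by blast
  then have "\<Psi> u \<in> T"
  proof (induction rule: primal.span_induct_alt)
    case base
    then show ?case by (simp add: module_hom.zero[OF hom] primal.subspace_0[OF T])
  next
    case (step b x y)
    then show ?case
      using gen[OF step(1)]
      by (simp add: module_hom.add[OF hom] module_hom.scale[OF hom] primal.subspace_add[OF T]
          primal.subspace_scale[OF T])
  qed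
  then show ?thesis by (simp add: T_def)
qed

section \<open>Tridiagonal systems given by primitive idempotents\<close>

lemma split_U_eq:
  assumes "i \<le> d"
  shows "split_U d E Es i = U i"
proof -
  have "primal.spectral_sum {i..d} = primal.spectral_sum {i..}"
    by (rule primal.spectral_sum_cong) auto
  then show ?thesis
    using assms by (simp add: split_U_def split_space_def primal.sum_ranges_eq_spectral_sum
        dual.sum_ranges_eq_spectral_sum atLeast0AtMost)
qed

lemma split_K_eq: "i \<le> d \<Longrightarrow> split_K d E Es i = K i"
  by (simp add: split_K_def K_def primal.sum_ranges_eq_spectral_sum
      dual.sum_ranges_eq_spectral_sum atLeast0AtMost)

end

lemma (in spectral_resolution) tridiagonal_of_ordering:
  assumes ord: "standard_ordering scale A B d (\<lambda>i. range (E i))"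
    and hk: "h \<le> d" "k \<le> d" "h + 1 < k \<or> k + 1 < h"
  shows "E h (B (E k v)) = 0"
proof -
  let ?I = "{j \<in> {0..d}. k \<le> j + 1 \<and> j \<le> k + 1}"
  have "B ` range (E k) \<subseteq> (\<Sum>j\<in>?I. range (E j))"
    using ord hk(2) by (simp add: standard_ordering_def)
  then have "B (E k v) \<in> (\<Sum>j\<in>?I. range (E j))" by blast
  also have "\<dots> = spectral_sum ?I" by (rule sum_ranges_eq_spectral_sum) auto
  finally show ?thesis using hk by (auto simp: spectral_sum_def)
qed

lemma tridiagonal_system_of_TD_system:
  assumes vs: "vector_space scale" and TD: "TD_system scale d A E Astar Estar"
  shows "tridiagonal_system scale d A Astar E Estar
    (\<lambda>i. eigenvalue_on scale A (range (E i))) (\<lambda>i. eigenvalue_on scale Astar (range (Estar i)))"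
proof -
  have pair: "TD_pair scale A Astar"
    and bij: "bij_betw E {0..d} {P. primitive_idempotent scale A P}"
      "bij_betw Estar {0..d} {P. primitive_idempotent scale Astar P}"
    and ord: "standard_ordering scale A Astar d (\<lambda>i. range (E i))"
      "standard_ordering scale Astar A d (\<lambda>i. range (Estar i))"
    using TD by (simp_all add: TD_system_def)
  have primal: "spectral_resolution scale d A E (\<lambda>i. eigenvalue_on scale A (range (E i)))"
    using pair ord(1)
    by (intro spectral_resolution_of_ordering vs bij)
      (simp_all add: TD_pair_def standard_ordering_def)
  have dual: "spectral_resolution scale d Astar Estar
      (\<lambda>i. eigenvalue_on scale Astar (range (Estar i)))"
    using pair ord(2)
    by (intro spectral_resolution_of_ordering vs bij)
      (simp_all add: TD_pair_def standard_ordering_def)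
  show ?thesis
  proof (intro tridiagonal_system.intro tridiagonal_system_axioms.intro primal dual)
    fix W assume "module.subspace scale W" "A ` W \<subseteq> W" "Astar ` W \<subseteq> W"
    then show "W = {0} \<or> W = UNIV" using pair unfolding TD_pair_def by blast
  qed (rule spectral_resolution.tridiagonal_of_ordering[OF primal ord(1)]
      spectral_resolution.tridiagonal_of_ordering[OF dual ord(2)], assumption+)+
qed

theorem lemma11p2:
  fixes scale :: "'k::field \<Rightarrow> 'v::ab_group_add \<Rightarrow> 'v"
    and Basis :: "'v set"
    and d :: nat
    and A Astar \<Psi> :: "'v \<Rightarrow> 'v"
    and E Estar :: "nat \<Rightarrow> 'v \<Rightarrow> 'v"
  assumes "finite_dimensional_vector_space scale Basis"
    and "vector_space.dim scale (UNIV :: 'v set) > 0"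
    and "TD_system scale d A E Astar Estar"
    and "d \<ge> 1"
    and "is_Psi scale d A E Estar \<Psi>"
  shows "(\<forall>j\<in>{1..d}. \<Psi> ` split_U d E Estar j \<subseteq> split_U d E Estar (j - 1)) \<and>
         \<Psi> ` split_U d E Estar 0 = {0}"
proof -
  define \<theta> where "\<theta> = (\<lambda>i. eigenvalue_on scale A (range (E i)))"
  define \<theta>s where "\<theta>s = (\<lambda>i. eigenvalue_on scale Astar (range (Estar i)))"
  have "vector_space scale"
    using assms(1) by (rule finite_dimensional_vector_space.axioms(1))
  then interpret tridiagonal_system scale d A Astar E Estar \<theta> \<theta>s
    unfolding \<theta>_def \<theta>s_def using assms(3) by (rule tridiagonal_system_of_TD_system)
  have lin: "Vector_Spaces.linear scale scale \<Psi>"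
    using assms(5) by (simp add: is_Psi_def)
  have \<Psi>: "\<Psi> (node_map i j v) =
      scale (vartheta \<theta> d j - vartheta \<theta> d i) (poly_map scale (tau \<theta> i (int j - 1)) A v)"
    if "i \<le> j" "i + j \<le> d" "v \<in> K i" for i j v
  proof -
    have "2 * i \<le> d" "j \<le> d - i" "i \<le> d" using that by auto
    moreover have "v \<in> split_K d E Estar i" using that split_K_eq by simp
    ultimately have "\<Psi> (poly_map scale (tau \<theta> i (int j)) A v) =
        scale (vartheta \<theta> d j - vartheta \<theta> d i) (poly_map scale (tau \<theta> i (int j - 1)) A v)"
      using assms(5) that(1) unfolding is_Psi_def Let_def \<theta>_def by blast
    then show ?thesis by (simp only: primal.tau_eq_node_poly[OF that(1)])
  qed
  note U = lowering_map_on_U[OF lin \<Psi>]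
  have "\<Psi> ` split_U d E Estar j \<subseteq> split_U d E Estar (j - 1)" if "j \<in> {1..d}" for j
    using U[of j] that by (auto simp: split_U_eq)
  moreover have "\<Psi> ` U 0 = {0}"
    using U[of 0] primal.subspace_0[OF subspace_split_space, of 0 0] by force
  ultimately show ?thesis by (simp add: split_U_eq)
qed

end
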